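(* Let $\alpha\in(0,1)$ and $\epsilon>0$, let $(X_1,Y_1),\dots,(X_n,Y_n),(X,Y)$ be i.i.d. random variables with values in $\mathbb{R}^d\times\mathbb{R}$ (with arbitrary common distribution), let $D=(X_i,Y_i)_{1\le i\le n}$, and let $D_1,D_2$ be a partition of $D$ into two disjoint subsamples, with $n_2=|D_2|$. Let $G_K=\{\tau_{(1)},\dots,\tau_{(K)}\}$ with $1>\tau_{(1)}>\dots>\tau_{(K)}>0$, and for each $\tau\in G_K$ let $N_\tau=N_{D_1,\tau}=(l_\tau,m_\tau,u_\tau)$ be a network fit on $D_1$ by minimizing the level-$\tau$ empirical risk on $D_1$. Let $$\hat p(N_\tau,D_2)=\frac{1}{n_2}\sum_{(X_i,Y_i)\in D_2}\mathbf{1}_{\{Y_i\in[l_\tau(X_i),u_\tau(X_i)]\}},$$ and let $\hat\tau=\tau_{(i)}$ for the smallest index $i\in\{1,\dots,K\}$ such that $\hat p(N_{\tau_{(i)}},D_2)\ge 1-\alpha$, and $\hat\tau=0$ if there is no such $i$. Set $\Gamma_\alpha^{\hat\tau}(x)=[l_{\hat\tau}(x),u_{\hat\tau}(x)]$, where $l_0\equiv-\infty$ and $u_0\equiv\infty$, and let $p(\Gamma_\alpha^{\hat\tau}|D)=\mathbb{P}(Y\in\Gamma_\alpha^{\hat\tau}(X)\mid D)$. Then $$\mathbb{P}\left(p(\Gamma_\alpha^{\hat\tau}|D)\le 1-\alpha-\epsilon\right)\le K\exp(-2\epsilon^2 n_2).$$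
   Context: Data splitting: $D_1$ and $D_2$ correspond to a fixed (not data-dependent) partition of the index set $\{1,\dots,n\}$, with $D_2$ nonempty. The new observation $(X,Y)$ is independent of $D$ and has the same distribution as each $(X_i,Y_i)$. Networks: a network is a function $N=(l,m,u):\mathbb{R}^d\to\mathbb{R}^3$ with $l(x)\le m(x)\le u(x)$ for all $x\in\mathbb{R}^d$. The architecture (the class of networks considered) is arbitrary and may depend on the data only through $D_1$. Loss: for $\tau\in[0,1]$ and $u\in\mathbb{R}$ let $h_\tau(u)=(\tau-\mathbf{1}_{\{u\le 0\}})u$. The level-$\tau$ loss is $$\mathcal{L}_\tau(N(x),y)=h_{\tau/2}(y-l(x))+h_{1/2}(y-m(x))+h_{1-\tau/2}(y-u(x)),$$ and the empirical risk of $N$ on $D'\subseteq D$ is $$\mathcal{R}_{D',\tau}(N)=\frac{1}{|D'|}\sum_{(X_i,Y_i)\in D'}\mathcal{L}_\tau(N(X_i),Y_i).$$ The network $N_{D_1,\tau}$ is one fit on $D_1$ by minimizing $\mathcal{R}_{D_1,\tau}$; it depends on the data only through $D_1$, and $(D_1,x)\mapsto N_{D_1,\tau}(x)$ is assumed measurable. In the trivial case $\tau=0$ the interval $[l_0(x),u_0(x)]$ is the whole real line. *)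

theory Defs
  imports "HOL-Probability.Probability"
begin

type_synonym 'd obs = "(real ^ 'd) \<times> real"

text \<open>A sample is a family of observations indexed by natural numbers; the subsample with index
  set \<open>I\<close> is \<open>restrict z I\<close>, a point of \<open>sample_space I\<close>.\<close>

type_synonym 'd sample = "nat \<Rightarrow> 'd obs"

abbreviation sample_space :: "nat set \<Rightarrow> ('d::finite) sample measure" where
  "sample_space I \<equiv> PiM I (\<lambda>_. borel)"

text \<open>The value \<open>N x\<close> is the triple \<open>(l x, m x, u x)\<close>.\<close>

type_synonym 'd network = "real ^ 'd \<Rightarrow> real \<times> real \<times> real"

definition networks :: "('d::finite) network set" where
  "networks = {N. \<forall>x. case N x of (l, m, u) \<Rightarrow> l \<le> m \<and> m \<le> u}"

definition pinball :: "real \<Rightarrow> real \<Rightarrow> real" where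
  "pinball \<tau> u = (\<tau> - indicator {..0} u) * u"

definition level_loss :: "real \<Rightarrow> real \<times> real \<times> real \<Rightarrow> real \<Rightarrow> real" where
  "level_loss \<tau> v y = (case v of (l, m, u) \<Rightarrow>
     pinball (\<tau> / 2) (y - l) + pinball (1 / 2) (y - m) + pinball (1 - \<tau> / 2) (y - u))"

definition emp_risk :: "nat set \<Rightarrow> ('d::finite) sample \<Rightarrow> real \<Rightarrow> 'd network \<Rightarrow> real" where
  "emp_risk I z \<tau> N = (\<Sum>i\<in>I. level_loss \<tau> (N (fst (z i))) (snd (z i))) / real (card I)"

definition net_interval :: "('d::finite) network \<Rightarrow> real ^ 'd \<Rightarrow> real set" where
  "net_interval N x = (case N x of (l, m, u) \<Rightarrow> {l..u})"

definition emp_coverage :: "('d::finite) network \<Rightarrow> nat set \<Rightarrow> 'd sample \<Rightarrow> real" where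
  "emp_coverage N I z = (\<Sum>i\<in>I. indicator (net_interval N (fst (z i))) (snd (z i))) / real (card I)"

text \<open>The argument \<open>\<tau>s\<close> enumerates the grid on \<open>{1..K}\<close>, and \<open>N \<tau>\<close> is the network fitted at
  level \<open>\<tau>\<close>.\<close>

definition tau_hat ::
  "real \<Rightarrow> nat \<Rightarrow> (nat \<Rightarrow> real) \<Rightarrow> (real \<Rightarrow> ('d::finite) network) \<Rightarrow> nat set \<Rightarrow> 'd sample \<Rightarrow> real" where
  "tau_hat \<alpha> K \<tau>s N I z =
     (if \<exists>i\<in>{1..K}. emp_coverage (N (\<tau>s i)) I z \<ge> 1 - \<alpha>
      then \<tau>s (LEAST i. i \<in> {1..K} \<and> emp_coverage (N (\<tau>s i)) I z \<ge> 1 - \<alpha>)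
      else 0)"

text \<open>Level \<open>0\<close> stands for the endpoints \<open>-\<infinity>\<close> and \<open>\<infinity>\<close>, whatever \<open>N 0\<close> is.\<close>

definition pred_set :: "(real \<Rightarrow> ('d::finite) network) \<Rightarrow> real \<Rightarrow> real ^ 'd \<Rightarrow> real set" where
  "pred_set N \<tau> x = (if \<tau> = 0 then UNIV else net_interval (N \<tau>) x)"

text \<open>A version of the conditional probability of the event \<open>A\<close> given the sigma-algebra generated
  by the random element \<open>D\<close> of \<open>S\<close>.\<close>

definition cond_prob_given :: "'a measure \<Rightarrow> 'b measure \<Rightarrow> ('a \<Rightarrow> 'b) \<Rightarrow> 'a set \<Rightarrow> 'a \<Rightarrow> real" where
  "cond_prob_given M S D A = real_cond_exp M (vimage_algebra (space M) D S) (indicator A)"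

end

theory Submission imports Defs begin

text \<open>Since \<open>(X, Y)\<close> is independent of \<open>D\<close>, the conditional coverage is almost surely the coverage
  under the law of \<open>(X, Y)\<close> of the selected set, with the data frozen. If it is at most
  \<open>1 - \<alpha> - \<epsilon>\<close>, the selected level is some \<open>\<tau>\<^sub>i\<close> on the grid (at level \<open>0\<close> the coverage is
  \<open>1\<close>), so the network at \<open>\<tau>\<^sub>i\<close> has empirical coverage at least \<open>1 - \<alpha>\<close> on \<open>D\<^sub>2\<close> and exceeds
  its true coverage by at least \<open>\<epsilon>\<close>. For each \<open>i\<close>, conditionally on \<open>D\<^sub>1\<close> the network is fixed, and
  Hoeffding's inequality bounds the probability of this event; a union bound over \<open>i\<close> concludes.\<close>

section \<open>Product laws and freezing one of two independent variables\<close>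

text \<open>Independence is passed on as an identity of laws because \<open>indep_var\<close> takes
  two variables with values in one type, while \<open>h\<close> may change the type. In the main
  proof \<open>h\<close> evaluates a one-point family at its index.\<close>

lemma (in prob_space) indep_var_distr_pair_map:
  assumes indep: "indep_var S U T V" and h [measurable]: "h \<in> T \<rightarrow>\<^sub>M T'"
  shows "distr M S U \<Otimes>\<^sub>M distr M T' (\<lambda>\<omega>. h (V \<omega>)) = distr M (S \<Otimes>\<^sub>M T') (\<lambda>\<omega>. (U \<omega>, h (V \<omega>)))"
proof -
  have [measurable]: "random_variable S U" "random_variable T V"
    using indep by (blast dest: indep_var_rv1 indep_var_rv2)+
  interpret PV: prob_space "distr (distr M T V) T' h"
    by (intro prob_space.prob_space_distr prob_space_distr) auto
  have "distr M S U \<Otimes>\<^sub>M distr M T' (\<lambda>\<omega>. h (V \<omega>)) =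
      distr (distr M S U) S (\<lambda>u. u) \<Otimes>\<^sub>M distr (distr M T V) T' h"
    by (simp add: distr_distr o_def)
  also have "\<dots> = distr (distr M S U \<Otimes>\<^sub>M distr M T V) (S \<Otimes>\<^sub>M T') (\<lambda>(u, v). (u, h v))"
    by (rule pair_measure_distr) (auto intro: PV.sigma_finite_measure_axioms)
  also have "\<dots> = distr M (S \<Otimes>\<^sub>M T') (\<lambda>\<omega>. (U \<omega>, h (V \<omega>)))"
    using indep by (simp add: indep_var_distribution_eq distr_distr o_def)
  finally show ?thesis .
qed

text \<open>Tonelli for the product law: measure the section of \<open>B\<close> at a frozen first
  coordinate, then integrate over the law of \<open>U\<close>. Measurability of the section measure
  is a conclusion of its own because the two lemmas that follow rely on it.\<close>

lemma (in prob_space) prob_product_law_eq_integral: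
  assumes U [measurable]: "random_variable S U" and V [measurable]: "random_variable T V"
    and indep: "distr M S U \<Otimes>\<^sub>M distr M T V = distr M (S \<Otimes>\<^sub>M T) (\<lambda>\<omega>. (U \<omega>, V \<omega>))"
    and B [measurable]: "B \<in> sets (S \<Otimes>\<^sub>M T)"
  shows "(\<lambda>u. measure (distr M T V) (Pair u -` B)) \<in> borel_measurable S"
    and "prob {\<omega> \<in> space M. (U \<omega>, V \<omega>) \<in> B} = (\<integral>\<omega>. measure (distr M T V) (Pair (U \<omega>) -` B) \<partial>M)"
proof -
  interpret PV: prob_space "distr M T V" by (rule prob_space_distr) fact
  have B': "B \<in> sets (N \<Otimes>\<^sub>M distr M T V)" if "sets N = sets S" for N
    using B sets_pair_measure_cong[OF that, of "distr M T V" T] by simp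
  define g where "g u = measure (distr M T V) (Pair u -` B)" for u
  have g_bound: "0 \<le> g u" "norm (g u) \<le> 1" for u
    unfolding g_def by simp_all
  show g [measurable]: "g \<in> borel_measurable S" unfolding g_def
    using PV.measurable_emeasure_Pair[OF B'[OF refl]] unfolding measure_def by measurable
  have "emeasure M {\<omega> \<in> space M. (U \<omega>, V \<omega>) \<in> B} =
      emeasure (distr M (S \<Otimes>\<^sub>M T) (\<lambda>\<omega>. (U \<omega>, V \<omega>))) B"
    by (subst emeasure_distr) (auto intro!: arg_cong[where f = "emeasure M"])
  also have "\<dots> = emeasure (distr M S U \<Otimes>\<^sub>M distr M T V) B"
    by (simp add: indep)
  also have "\<dots> = (\<integral>\<^sup>+u. ennreal (g u) \<partial>distr M S U)"
    by (subst PV.emeasure_pair_measure_alt[OF B']) (auto simp: g_def PV.emeasure_eq_measure)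
  also have "\<dots> = (\<integral>\<^sup>+\<omega>. ennreal (g (U \<omega>)) \<partial>M)"
    by (rule nn_integral_distr) measurable
  also have "\<dots> = ennreal (\<integral>\<omega>. g (U \<omega>) \<partial>M)"
    by (intro nn_integral_eq_integral integrable_const_bound[where B = 1])
      (use g_bound in \<open>auto intro!: AE_I2\<close>)
  finally show "prob {\<omega> \<in> space M. (U \<omega>, V \<omega>) \<in> B} = (\<integral>\<omega>. g (U \<omega>) \<partial>M)"
    by (simp add: emeasure_eq_measure g_def integral_nonneg_AE)
qed

text \<open>The freezing lemma. The candidate is a measurable function of \<open>U\<close> alone,
  hence measurable for the sigma-algebra generated by \<open>U\<close>, so what remains is to
  compare integrals over the events of that sigma-algebra.\<close>

lemma (in prob_space) real_cond_exp_indicator_product_law: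
  assumes U [measurable]: "random_variable S U" and V [measurable]: "random_variable T V"
    and indep: "distr M S U \<Otimes>\<^sub>M distr M T V = distr M (S \<Otimes>\<^sub>M T) (\<lambda>\<omega>. (U \<omega>, V \<omega>))"
    and A [measurable]: "A \<in> sets (S \<Otimes>\<^sub>M T)"
  shows "AE \<omega> in M. real_cond_exp M (vimage_algebra (space M) U S)
      (indicator {\<omega> \<in> space M. (U \<omega>, V \<omega>) \<in> A}) \<omega> = measure (distr M T V) (Pair (U \<omega>) -` A)"
proof -
  interpret PV: prob_space "distr M T V" by (rule prob_space_distr) fact
  let ?F = "vimage_algebra (space M) U S"
  have UF: "U \<in> space M \<rightarrow> space S"
    by (auto simp: measurable_space[OF U])
  have sub: "subalgebra M ?F"
    unfolding subalgebra_def
    by (auto simp: sets_vimage_algebra2[OF UF] intro!: measurable_sets[OF U])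
  interpret F: sigma_finite_subalgebra M ?F
    by (intro finite_measure_subalgebra_is_sigma_finite finite_measure_subalgebra.intro
        finite_measure_axioms finite_measure_subalgebra_axioms.intro sub)
  have U_F: "U \<in> measurable ?F S"
    by (intro measurable_vimage_algebra1) (rule UF)
  define g where "g u = measure (distr M T V) (Pair u -` A)" for u
  have g [measurable]: "g \<in> borel_measurable S"
    unfolding g_def by (rule prob_product_law_eq_integral(1)[OF U V indep A])
  have g_bound: "norm (g u) \<le> 1" for u
    unfolding g_def by simp
  show ?thesis
    unfolding g_def[symmetric]
  proof (rule F.real_cond_exp_charact)
    show "integrable M (indicator {\<omega> \<in> space M. (U \<omega>, V \<omega>) \<in> A} :: 'a \<Rightarrow> real)"
      by (rule integrable_const_bound[where B = 1]) auto
    show "integrable M (\<lambda>\<omega>. g (U \<omega>))"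
      by (rule integrable_const_bound[where B = 1]) (use g_bound in auto)
    show "(\<lambda>\<omega>. g (U \<omega>)) \<in> borel_measurable ?F"
      by (rule measurable_compose[OF U_F g])
  next
    fix E assume "E \<in> sets ?F"
    then obtain B where B [measurable]: "B \<in> sets S" and E: "E = U -` B \<inter> space M"
      by (auto simp: sets_vimage_algebra2[OF UF])
    \<comment> \<open>Integrating over \<open>E\<close> amounts to cutting \<open>A\<close> down by
      the rectangle \<open>B \<times> space T\<close>, so the section formula for the cut set gives
      the required identity.\<close>
    have C: "A \<inter> B \<times> space T \<in> sets (S \<Otimes>\<^sub>M T)"
      by measurable
    have AT: "A \<subseteq> space S \<times> space T"
      using sets.sets_into_space[OF A] by (simp add: space_pair_measure)
    have "(\<integral>\<omega>\<in>E. indicator {\<omega> \<in> space M. (U \<omega>, V \<omega>) \<in> A} \<omega> \<partial>M) =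
        (\<integral>\<omega>. indicator {\<omega> \<in> space M. (U \<omega>, V \<omega>) \<in> A \<inter> B \<times> space T} \<omega> \<partial>M)"
      unfolding set_lebesgue_integral_def
      by (intro Bochner_Integration.integral_cong refl)
        (use AT in \<open>auto simp: indicator_def E\<close>)
    also have "\<dots> = prob {\<omega> \<in> space M. (U \<omega>, V \<omega>) \<in> A \<inter> B \<times> space T}"
      by (simp add: Int_def conj_ac)
    also have "\<dots> = (\<integral>\<omega>. measure (distr M T V) (Pair (U \<omega>) -` (A \<inter> B \<times> space T)) \<partial>M)"
      by (rule prob_product_law_eq_integral(2)[OF U V indep C])
    also have "\<dots> = (\<integral>\<omega>. indicator B (U \<omega>) * g (U \<omega>) \<partial>M)"
    proof (intro Bochner_Integration.integral_cong refl)
      fix \<omega>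
      have "Pair (U \<omega>) -` (A \<inter> B \<times> space T) = (if U \<omega> \<in> B then Pair (U \<omega>) -` A else {})"
        using AT by auto
      then show "measure (distr M T V) (Pair (U \<omega>) -` (A \<inter> B \<times> space T)) =
          indicator B (U \<omega>) * g (U \<omega>)"
        by (simp add: g_def)
    qed
    also have "\<dots> = (\<integral>\<omega>\<in>E. g (U \<omega>) \<partial>M)"
      unfolding set_lebesgue_integral_def
      by (intro Bochner_Integration.integral_cong refl) (auto simp: E indicator_def)
    finally show "(\<integral>\<omega>\<in>E. indicator {\<omega> \<in> space M. (U \<omega>, V \<omega>) \<in> A} \<omega> \<partial>M) =
        (\<integral>\<omega>\<in>E. g (U \<omega>) \<partial>M)" .
  qed
qed

lemma (in prob_space) prob_product_law_le:
  assumes U [measurable]: "random_variable S U" and V [measurable]: "random_variable T V"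
    and indep: "distr M S U \<Otimes>\<^sub>M distr M T V = distr M (S \<Otimes>\<^sub>M T) (\<lambda>\<omega>. (U \<omega>, V \<omega>))"
    and B [measurable]: "B \<in> sets (S \<Otimes>\<^sub>M T)"
    and le: "\<And>u. u \<in> space S \<Longrightarrow> measure (distr M T V) (Pair u -` B) \<le> c"
  shows "prob {\<omega> \<in> space M. (U \<omega>, V \<omega>) \<in> B} \<le> c"
proof -
  interpret PV: prob_space "distr M T V" by (rule prob_space_distr) fact
  have g [measurable]: "(\<lambda>u. measure (distr M T V) (Pair u -` B)) \<in> borel_measurable S"
    by (rule prob_product_law_eq_integral(1)[OF U V indep B])
  have "(\<integral>\<omega>. measure (distr M T V) (Pair (U \<omega>) -` B) \<partial>M) \<le> (\<integral>\<omega>. c \<partial>M)"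
  proof (rule integral_mono)
    show "integrable M (\<lambda>\<omega>. measure (distr M T V) (Pair (U \<omega>) -` B))"
      by (rule integrable_const_bound[where B = 1]) auto
  qed (auto intro: le measurable_space[OF U])
  then show ?thesis
    by (simp add: prob_product_law_eq_integral(2)[OF U V indep B] prob_space)
qed

section \<open>Concentration of frequencies and measurability of prediction intervals\<close>

text \<open>The membership indicators of an i.i.d. sample are i.i.d. in [0, 1] with mean
  \<open>measure P C\<close>, so the interval length entering Hoeffding's exponent is 1.\<close>

lemma (in prob_space) Hoeffding_empirical_measure_ge:
  assumes "finite I" "I \<noteq> {}" and indep: "indep_vars (\<lambda>_. S) W I"
    and distr: "\<And>i. i \<in> I \<Longrightarrow> distr M S (W i) = P"
    and C [measurable]: "C \<in> sets S" and "\<epsilon> \<ge> 0"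
  shows "prob {\<omega> \<in> space M. (\<Sum>i\<in>I. indicator C (W i \<omega>)) / real (card I) \<ge> measure P C + \<epsilon>}
    \<le> exp (- 2 * \<epsilon>\<^sup>2 * real (card I))"
proof -
  obtain j where j: "j \<in> I" using assms by auto
  have W [measurable]: "i \<in> I \<Longrightarrow> random_variable S (W i)" for i
    using indep by (auto simp: indep_vars_def)
  have Wj [measurable]: "random_variable S (W j)" by (rule W[OF j])
  have d: "distr M borel (\<lambda>\<omega>. indicator C (W i \<omega>) :: real) = distr P borel (indicator C)"
    if i: "i \<in> I" for i
    unfolding distr[OF i, symmetric] using W[OF i] by (subst distr_distr) (auto simp: o_def)
  \<comment> \<open>The variable at the chosen index \<open>j\<close> represents the common law of
    all the indicators.\<close>
  interpret H: Hoeffding_ineq_iid M I "\<lambda>i \<omega>. indicator C (W i \<omega>)" "\<lambda>\<omega>. indicator C (W j \<omega>)" 0 1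
    "measure P C"
  proof unfold_locales
    show "indep_vars (\<lambda>_. borel) (\<lambda>i \<omega>. indicator C (W i \<omega>)) I"
      by (rule indep_vars_compose2[OF indep]) auto
    have "expectation (\<lambda>\<omega>. indicat_real C (W j \<omega>)) = (\<integral>x. indicator C x \<partial>distr M S (W j))"
      by (rule integral_distr[symmetric]) auto
    also have "\<dots> = measure P C"
      using sets.sets_into_space[OF C] distr[OF j] by (auto simp: Int_absorb2)
    finally show "measure P C \<equiv> expectation (\<lambda>\<omega>. indicat_real C (W j \<omega>))" by simp
  qed (use assms j d in \<open>auto simp: indicator_def\<close>)
  show ?thesis
    using H.Hoeffding_ineq_ge'[OF \<open>\<epsilon> \<ge> 0\<close> _ \<open>I \<noteq> {}\<close>] by (simp add: mult_ac)
qed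

text \<open>The endpoints are the outer components of a jointly measurable triple, and lying between
  them is a measurable comparison. A map \<open>f\<close> in place of a fixed sample allows random
  training data.\<close>

lemma measurable_pred_net_interval:
  fixes fit :: "'z \<Rightarrow> ('d::finite) network"
  assumes fit: "(\<lambda>(z, x). fit z x) \<in> borel_measurable (S \<Otimes>\<^sub>M borel)"
    and [measurable]: "f \<in> measurable M S" "g \<in> borel_measurable M" "h \<in> borel_measurable M"
  shows "Measurable.pred M (\<lambda>\<omega>. h \<omega> \<in> net_interval (fit (f \<omega>)) (g \<omega>))"
proof -
  have "(\<lambda>\<omega>. (case (f \<omega>, g \<omega>) of (z, x) \<Rightarrow> fit z x)) \<in> borel_measurable M"
    by (rule measurable_compose[OF _ fit]) measurable
  then have [measurable]: "(\<lambda>\<omega>. fit (f \<omega>) (g \<omega>)) \<in> M \<rightarrow>\<^sub>M borel \<Otimes>\<^sub>M borel \<Otimes>\<^sub>M borel"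
    by (simp add: borel_prod)
  have "Measurable.pred M (\<lambda>\<omega>. fst (fit (f \<omega>) (g \<omega>)) \<le> h \<omega> \<and> h \<omega> \<le> snd (snd (fit (f \<omega>) (g \<omega>))))"
    by measurable
  then show ?thesis
    by (simp add: net_interval_def case_prod_beta)
qed

theorem theorem2:
  fixes M :: "'a measure"
    and n K :: nat
    and \<alpha> \<epsilon> :: real
    and Xs :: "nat \<Rightarrow> 'a \<Rightarrow> real ^ ('d::finite)" and Ys :: "nat \<Rightarrow> 'a \<Rightarrow> real"
    and X :: "'a \<Rightarrow> real ^ 'd" and Y :: "'a \<Rightarrow> real"
    and D :: "'a \<Rightarrow> 'd sample"
    and I1 I2 :: "nat set"
    and \<tau>s :: "nat \<Rightarrow> real"
    and arch :: "real \<Rightarrow> 'd sample \<Rightarrow> 'd network set"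
    and fit :: "real \<Rightarrow> 'd sample \<Rightarrow> 'd network"
    and N :: "'a \<Rightarrow> real \<Rightarrow> 'd network"
    and \<tau>h :: "'a \<Rightarrow> real"
    and p :: "'a \<Rightarrow> real"
  assumes "prob_space M"
    and "0 < \<alpha>" "\<alpha> < 1" "0 < \<epsilon>"
    and D_def: "D = (\<lambda>\<omega>. \<lambda>i\<in>{1..n}. (Xs i \<omega>, Ys i \<omega>))"
    and indep: "prob_space.indep_vars M (\<lambda>_. borel)
      (\<lambda>i \<omega>. if i \<le> n then (Xs i \<omega>, Ys i \<omega>) else (X \<omega>, Y \<omega>)) {1..Suc n}"
    and ident: "\<forall>i\<in>{1..n}. distr M borel (\<lambda>\<omega>. (Xs i \<omega>, Ys i \<omega>)) = distr M borel (\<lambda>\<omega>. (X \<omega>, Y \<omega>))"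
    and partition: "I1 \<union> I2 = {1..n}" "I1 \<inter> I2 = {}" "I2 \<noteq> {}"
    and grid: "\<forall>i\<in>{1..K}. 0 < \<tau>s i \<and> \<tau>s i < 1"
      "\<forall>i\<in>{1..K}. \<forall>j\<in>{1..K}. i < j \<longrightarrow> \<tau>s j < \<tau>s i"
    and arch: "\<forall>\<tau>\<in>\<tau>s ` {1..K}. \<forall>z\<in>space (sample_space I1). arch \<tau> z \<subseteq> networks"
    and fit: "\<forall>\<tau>\<in>\<tau>s ` {1..K}. \<forall>z\<in>space (sample_space I1).
      is_arg_min (emp_risk I1 z \<tau>) (\<lambda>N. N \<in> arch \<tau> z) (fit \<tau> z)"
    and fit_measurable: "\<forall>\<tau>\<in>\<tau>s ` {1..K}.
      (\<lambda>(z, x). fit \<tau> z x) \<in> borel_measurable (sample_space I1 \<Otimes>\<^sub>M borel)"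
    and N_def: "N = (\<lambda>\<omega> \<tau>. fit \<tau> (restrict (D \<omega>) I1))"
    and \<tau>h_def: "\<tau>h = (\<lambda>\<omega>. tau_hat \<alpha> K \<tau>s (N \<omega>) I2 (restrict (D \<omega>) I2))"
    and p_def: "p = cond_prob_given M (sample_space {1..n}) D
      {\<omega> \<in> space M. Y \<omega> \<in> pred_set (N \<omega>) (\<tau>h \<omega>) (X \<omega>)}"
  shows "measure M {\<omega> \<in> space M. p \<omega> \<le> 1 - \<alpha> - \<epsilon>} \<le> real K * exp (- 2 * \<epsilon>\<^sup>2 * real (card I2))"
proof -

  \<comment> \<open>The sample and the new observation as one independent family\<close>
  interpret prob_space M by fact
  \<comment> \<open>The new observation sits at index \<open>Suc n\<close>. Both independence facts,
    of \<open>D\<close> from the new observation and of the two subsamples from each other, then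
    come from restricting \<open>W\<close> to disjoint index blocks.\<close>
  define W where "W = (\<lambda>i \<omega>. if i \<le> n then (Xs i \<omega>, Ys i \<omega>) else (X \<omega>, Y \<omega>))"
  define P where "P = distr M borel (\<lambda>\<omega>. (X \<omega>, Y \<omega>))"
  define Z where "Z = (\<lambda>\<omega>. (X \<omega>, Y \<omega>))"
  \<comment> \<open>The region of observations covered by the fitted network. Its measure under
    \<open>P\<close> is the true coverage, and its frequency in the second subsample is the
    empirical coverage.\<close>
  define C where "C \<tau> z = {w. snd w \<in> net_interval (fit \<tau> z) (fst w)}" for \<tau> z
  define cov where "cov \<tau> z d \<longleftrightarrow> emp_coverage (fit \<tau> z) I2 d \<ge> 1 - \<alpha>" for \<tau> z and d :: "'d sample"
  let ?S = "sample_space {1..n} :: 'd sample measure"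
  let ?S1 = "sample_space I1 :: 'd sample measure"
  let ?S2 = "sample_space I2 :: 'd sample measure"
  let ?G = "\<tau>s ` {1..K}"
  have I: "I1 \<subseteq> {1..n}" "I2 \<subseteq> {1..n}" "finite I2"
    using partition finite_subset[of I2 "{1..n}"] by auto
  have W: "indep_vars (\<lambda>_. borel) W {1..Suc n}"
    using indep unfolding W_def .
  have W_meas: "i \<in> {1..Suc n} \<Longrightarrow> W i \<in> borel_measurable M" for i
    using W by (auto simp: indep_vars_def)
  have Z_eq: "Z = W (Suc n)"
    by (auto simp: Z_def W_def)
  have Z [measurable]: "Z \<in> borel_measurable M"
    unfolding Z_eq by (rule W_meas) auto
  interpret P: prob_space P
    unfolding P_def using Z by (intro prob_space_distr) (simp add: Z_def)
  have distr_W: "distr M borel (W i) = P" if "i \<in> {1..n}" for i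
    using that ident by (auto simp: W_def P_def)
  have D_W: "restrict (D \<omega>) I = restrict (\<lambda>i. W i \<omega>) I" if "I \<subseteq> {1..n}" for I \<omega>
    using that by (auto simp: D_def W_def restrict_def fun_eq_iff)
  have D_eq: "D \<omega> = restrict (\<lambda>i. W i \<omega>) {1..n}" for \<omega>
    using D_W[of "{1..n}"] by (simp add: D_def)

  \<comment> \<open>Independence of the data blocks\<close>
  have indep_D: "indep_var ?S D (PiM {Suc n} (\<lambda>_. borel)) (\<lambda>\<omega>. restrict (\<lambda>i. W i \<omega>) {Suc n})"
    using indep_var_restrict[OF W, of "{1..n}" "{Suc n}"] by (simp add: D_eq[abs_def])
  have D [measurable]: "D \<in> M \<rightarrow>\<^sub>M ?S"
    using indep_D by (rule indep_var_rv1)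
  \<comment> \<open>Evaluation at \<open>Suc n\<close> turns the one-point family into
    \<open>Z\<close>, whose value type differs from that of \<open>D\<close>.\<close>
  have indep_DZ: "distr M ?S D \<Otimes>\<^sub>M distr M borel Z = distr M (?S \<Otimes>\<^sub>M borel) (\<lambda>\<omega>. (D \<omega>, Z \<omega>))"
    using indep_var_distr_pair_map[OF indep_D, of "\<lambda>r. r (Suc n)" borel] by (simp add: Z_eq)
  have indep_12: "indep_var ?S1 (\<lambda>\<omega>. restrict (D \<omega>) I1) ?S2 (\<lambda>\<omega>. restrict (D \<omega>) I2)"
    unfolding D_W[OF I(1)] D_W[OF I(2)]
    by (rule indep_var_restrict[OF W]) (use partition I in auto)
  note D1_meas = indep_var_rv1[OF indep_12] and D2_meas = indep_var_rv2[OF indep_12]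
    and distr_12 = indep_12[unfolded indep_var_distribution_eq, THEN conjunct2, THEN conjunct2]
  have restr_meas [measurable]: "(\<lambda>d. restrict d I1) \<in> ?S \<rightarrow>\<^sub>M ?S1" "(\<lambda>d. restrict d I2) \<in> ?S \<rightarrow>\<^sub>M ?S2"
    using I by (auto intro: measurable_restrict_subset)

  \<comment> \<open>Measurability of coverage in the data\<close>
  have fst_snd [measurable]: "fst \<in> borel_measurable (borel :: 'd obs measure)"
    "snd \<in> borel_measurable (borel :: 'd obs measure)"
    by (auto simp flip: borel_prod)
  \<comment> \<open>Joint measurability in the training data and the observation is what the random
    network requires; general \<open>f\<close> and \<open>h\<close> serve all the product spaces
    below.\<close>
  have C_pred: "Measurable.pred L (\<lambda>v. h v \<in> C \<tau> (f v))"
    if "\<tau> \<in> ?G" and [measurable]: "f \<in> L \<rightarrow>\<^sub>M ?S1" "h \<in> borel_measurable L"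
    for \<tau> and L :: "'v measure" and f h
    unfolding C_def mem_Collect_eq
    by (rule measurable_pred_net_interval[where S = ?S1])
      (use fit_measurable \<open>\<tau> \<in> ?G\<close> in auto)
  have C_sets: "C \<tau> z \<in> sets borel" if "\<tau> \<in> ?G" "z \<in> space ?S1" for \<tau> z
  proof -
    have "Measurable.pred borel (\<lambda>w. w \<in> C \<tau> z)"
      by (rule C_pred[OF that(1)]) (use that in auto)
    then show ?thesis
      by (simp add: pred_def)
  qed
  have emp_coverage_eq: "emp_coverage (fit \<tau> z) I2 d = (\<Sum>i\<in>I2. indicator (C \<tau> z) (d i)) / real (card I2)"
    for \<tau> z d
    by (simp add: emp_coverage_def C_def indicator_def)
  have cov_pred: "Measurable.pred L (\<lambda>v. cov \<tau> (f v) (g v))"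
    if \<tau>: "\<tau> \<in> ?G" and f [measurable]: "f \<in> L \<rightarrow>\<^sub>M ?S1" and g [measurable]: "g \<in> L \<rightarrow>\<^sub>M ?S2"
    for \<tau> and L :: "'v measure" and f g
  proof -
    have "(\<lambda>v. indicator (C \<tau> (f v)) (g v i) :: real) \<in> borel_measurable L" if "i \<in> I2" for i
    proof -
      have "Measurable.pred L (\<lambda>v. g v i \<in> C \<tau> (f v))"
        by (rule C_pred[OF \<tau> f]) (rule measurable_compose[OF g measurable_component_singleton[OF that]])
      then have "(\<lambda>v. if g v i \<in> C \<tau> (f v) then 1 else 0 :: real) \<in> borel_measurable L"
        by measurable
      then show ?thesis
        by (simp add: indicator_def of_bool_def)
    qed
    then show ?thesis
      unfolding cov_def emp_coverage_eq by measurable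
  qed

  \<comment> \<open>The selected level and its conditional coverage\<close>
  define k where "k d = (LEAST i. i \<in> {1..K} \<and> cov (\<tau>s i) (restrict d I1) (restrict d I2))" for d
  \<comment> \<open>If no index qualifies, \<open>k\<close> is unspecified, but the premise on
    \<open>cov\<close> then fails for every \<open>i\<close>, so the section of \<open>A\<close> is
    the whole space, as level 0 demands. Splitting by the value of \<open>k\<close> leaves finitely
    many conditions at deterministic levels.\<close>
  define A where "A = {v \<in> space (?S \<Otimes>\<^sub>M borel). \<forall>i\<in>{1..K}. k (fst v) = i \<longrightarrow>
      cov (\<tau>s i) (restrict (fst v) I1) (restrict (fst v) I2) \<longrightarrow> snd v \<in> C (\<tau>s i) (restrict (fst v) I1)}"
  have k_least: "k d \<in> {1..K}" "cov (\<tau>s (k d)) (restrict d I1) (restrict d I2)"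
    if "i \<in> {1..K}" "cov (\<tau>s i) (restrict d I1) (restrict d I2)" for i d
    using LeastI[of "\<lambda>i. i \<in> {1..K} \<and> cov (\<tau>s i) (restrict d I1) (restrict d I2)" i] that
    unfolding k_def by blast+
  \<comment> \<open>Measurability of a least index is derived from that of the predicate at every
    natural number; outside the grid indices the predicate is constantly false.\<close>
  have cov_pred_S: "Measurable.pred ?S (\<lambda>d. i \<in> {1..K} \<and> cov (\<tau>s i) (restrict d I1) (restrict d I2))" for i
  proof (cases "i \<in> {1..K}")
    case True
    then show ?thesis
      using cov_pred[of "\<tau>s i" "\<lambda>d. restrict d I1" ?S "\<lambda>d. restrict d I2"] restr_meas by auto
  next
    case False
    then show ?thesis
      by (simp only: simp_thms) (rule measurable_const, simp)
  qed
  have k_meas [measurable]: "k \<in> ?S \<rightarrow>\<^sub>M count_space UNIV"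
    unfolding k_def[abs_def] by (rule measurable_Least) (rule cov_pred_S)
  have A_sets: "A \<in> sets (?S \<Otimes>\<^sub>M borel)"
  proof -
    have *: "Measurable.pred (?S \<Otimes>\<^sub>M borel) (\<lambda>v. cov (\<tau>s i) (restrict (fst v) I1) (restrict (fst v) I2))"
      "Measurable.pred (?S \<Otimes>\<^sub>M borel) (\<lambda>v. snd v \<in> C (\<tau>s i) (restrict (fst v) I1))"
      if "i \<in> {1..K}" for i
      using that
      by (auto simp del: One_nat_def intro!: cov_pred C_pred
          measurable_compose[OF measurable_fst restr_meas(1)]
          measurable_compose[OF measurable_fst restr_meas(2)])
    have "Measurable.pred (?S \<Otimes>\<^sub>M borel) (\<lambda>v. k (fst v) = i \<longrightarrow>
      cov (\<tau>s i) (restrict (fst v) I1) (restrict (fst v) I2) \<longrightarrow> snd v \<in> C (\<tau>s i) (restrict (fst v) I1))"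
      if "i \<in> {1..K}" for i
    proof -
      note *[OF that, measurable]
      show ?thesis by measurable
    qed
    then have "Measurable.pred (?S \<Otimes>\<^sub>M borel) (\<lambda>v. \<forall>i\<in>{1..K}. k (fst v) = i \<longrightarrow>
      cov (\<tau>s i) (restrict (fst v) I1) (restrict (fst v) I2) \<longrightarrow> snd v \<in> C (\<tau>s i) (restrict (fst v) I1))"
      by (intro pred_intros_finite) auto
    then show ?thesis
      unfolding A_def by (simp add: pred_def)
  qed
  have D_space: "D \<omega> \<in> space ?S" for \<omega>
    by (auto simp: D_def space_PiM)
  have A_pred: "(D \<omega>, w) \<in> A \<longleftrightarrow> snd w \<in> pred_set (N \<omega>) (\<tau>h \<omega>) (fst w)" for \<omega> w
  proof (cases "\<exists>i\<in>{1..K}. cov (\<tau>s i) (restrict (D \<omega>) I1) (restrict (D \<omega>) I2)")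
    case True
    then have k: "k (D \<omega>) \<in> {1..K}" "cov (\<tau>s (k (D \<omega>))) (restrict (D \<omega>) I1) (restrict (D \<omega>) I2)"
      using k_least by blast+
    have "\<tau>h \<omega> = \<tau>s (k (D \<omega>))"
      using True unfolding \<tau>h_def tau_hat_def k_def N_def cov_def by auto
    \<comment> \<open>Positivity of the grid keeps a selected level apart from the value 0, which
      \<open>pred_set\<close> reads as the whole line.\<close>
    moreover have "\<tau>s (k (D \<omega>)) \<noteq> 0"
      using grid(1) k(1) by force
    ultimately show ?thesis
      using k D_space by (auto simp: A_def space_pair_measure pred_set_def C_def N_def)
  next
    case False
    then have "\<tau>h \<omega> = 0"
      unfolding \<tau>h_def tau_hat_def N_def cov_def by auto
    then show ?thesis
      using False D_space by (auto simp: A_def space_pair_measure pred_set_def)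
  qed
  \<comment> \<open>The data, including the selected index, are frozen at \<open>D \<omega>\<close>,
    and only the new observation is averaged.\<close>
  have p_eq: "AE \<omega> in M. p \<omega> = measure P (Pair (D \<omega>) -` A)"
    using real_cond_exp_indicator_product_law[OF D Z indep_DZ A_sets]
    by (simp add: p_def cond_prob_given_def A_pred Z_def P_def)

  \<comment> \<open>The bad event at one fixed level\<close>
  define B where "B i = {v \<in> space (?S1 \<Otimes>\<^sub>M ?S2). cov (\<tau>s i) (fst v) (snd v) \<and>
      measure P (C (\<tau>s i) (fst v)) \<le> 1 - \<alpha> - \<epsilon>}" for i
  have B_sets: "B i \<in> sets (?S1 \<Otimes>\<^sub>M ?S2)" if i: "i \<in> {1..K}" for i
  proof -
    have \<tau>: "\<tau>s i \<in> ?G" using i by auto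
    \<comment> \<open>\<open>C (\<tau>s i) z\<close> is the section at \<open>z\<close> of this
      jointly measurable set, which makes the true coverage measurable in the training data.\<close>
    let ?Q = "{v \<in> space (?S1 \<Otimes>\<^sub>M borel). snd v \<in> C (\<tau>s i) (fst v)}"
    have "?Q \<in> sets (?S1 \<Otimes>\<^sub>M P)"
      using C_pred[OF \<tau>, of fst "?S1 \<Otimes>\<^sub>M borel" snd]
      by (simp add: pred_def P_def cong: sets_pair_measure_cong)
    from P.measurable_emeasure_Pair[OF this]
    have "(\<lambda>z. measure P (Pair z -` ?Q)) \<in> borel_measurable ?S1"
      unfolding measure_def by measurable
    also have "?this \<longleftrightarrow> (\<lambda>z. measure P (C (\<tau>s i) z)) \<in> borel_measurable ?S1"
      by (intro measurable_cong arg_cong[where f = "measure P"]) (auto simp: space_pair_measure)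
    finally have [measurable]: "(\<lambda>z. measure P (C (\<tau>s i) z)) \<in> borel_measurable ?S1" .
    have [measurable]: "Measurable.pred (?S1 \<Otimes>\<^sub>M ?S2) (\<lambda>v. cov (\<tau>s i) (fst v) (snd v))"
      by (rule cov_pred[OF \<tau>]) auto
    show ?thesis
      unfolding B_def by measurable
  qed
  define E where "E i = {\<omega> \<in> space M. (restrict (D \<omega>) I1, restrict (D \<omega>) I2) \<in> B i}" for i
  have E_le: "prob (E i) \<le> exp (- 2 * \<epsilon>\<^sup>2 * real (card I2))" if i: "i \<in> {1..K}" for i
    unfolding E_def
  proof (rule prob_product_law_le[OF D1_meas D2_meas distr_12 B_sets[OF i]])
    \<comment> \<open>For fixed \<open>z\<close> the network is deterministic, and the second
      subsample keeps its i.i.d. law because the blocks are independent.\<close>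
    fix z assume z: "z \<in> space ?S1"
    have Cz: "C (\<tau>s i) z \<in> sets borel"
      using C_sets i z by auto
    have "measure (distr M ?S2 (\<lambda>\<omega>. restrict (D \<omega>) I2)) (Pair z -` B i) =
        prob {\<omega> \<in> space M. (z, restrict (D \<omega>) I2) \<in> B i}"
      by (subst measure_distr[OF D2_meas])
        (auto intro!: arg_cong[where f = prob] sets_Pair1 B_sets i)
    \<comment> \<open>The two conditions in \<open>B i\<close> chain through
      \<open>1 - \<alpha>\<close>: the frequency is at least this number, and the true coverage is
      at most this number minus \<epsilon>.\<close>
    also have "\<dots> \<le> prob {\<omega> \<in> space M.
        (\<Sum>j\<in>I2. indicator (C (\<tau>s i) z) (W j \<omega>)) / real (card I2) \<ge> measure P (C (\<tau>s i) z) + \<epsilon>}"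
    proof (rule finite_measure_mono)
      have [measurable]: "(\<lambda>\<omega>. indicator (C (\<tau>s i) z) (W j \<omega>) :: real) \<in> borel_measurable M"
        if "j \<in> I2" for j
        using that I Cz by (intro measurable_compose[OF W_meas[of j]]) auto
      show "{\<omega> \<in> space M. (\<Sum>j\<in>I2. indicator (C (\<tau>s i) z) (W j \<omega>)) / real (card I2)
          \<ge> measure P (C (\<tau>s i) z) + \<epsilon>} \<in> events"
        by measurable
    qed (auto simp: B_def cov_def emp_coverage_eq D_W[OF I(2)])
    also have "\<dots> \<le> exp (- 2 * \<epsilon>\<^sup>2 * real (card I2))"
      by (rule Hoeffding_empirical_measure_ge[where S = borel])
        (use I partition(3) distr_W Cz assms(4) in
          \<open>auto simp del: One_nat_def intro!: indep_vars_subset[OF W]\<close>)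
    finally show "measure (distr M ?S2 (\<lambda>\<omega>. restrict (D \<omega>) I2)) (Pair z -` B i) \<le>
      exp (- 2 * \<epsilon>\<^sup>2 * real (card I2))" .
  qed
  have E_sets: "E i \<in> events" if "i \<in> {1..K}" for i
  proof -
    have "(\<lambda>\<omega>. (restrict (D \<omega>) I1, restrict (D \<omega>) I2)) \<in> M \<rightarrow>\<^sub>M ?S1 \<Otimes>\<^sub>M ?S2"
      using D1_meas D2_meas by measurable
    from measurable_sets[OF this B_sets[OF that]] show ?thesis
      by (simp add: E_def vimage_def Int_def conj_commute)
  qed

  \<comment> \<open>Union bound over the grid\<close>
  have bad: "\<omega> \<in> (\<Union>i\<in>{1..K}. E i)"
    if \<omega>: "\<omega> \<in> space M" and le: "measure P (Pair (D \<omega>) -` A) \<le> 1 - \<alpha> - \<epsilon>" for \<omega>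
  proof (cases "\<exists>i\<in>{1..K}. cov (\<tau>s i) (restrict (D \<omega>) I1) (restrict (D \<omega>) I2)")
    case True
    then have k: "k (D \<omega>) \<in> {1..K}" "cov (\<tau>s (k (D \<omega>))) (restrict (D \<omega>) I1) (restrict (D \<omega>) I2)"
      using k_least by blast+
    have "Pair (D \<omega>) -` A = C (\<tau>s (k (D \<omega>))) (restrict (D \<omega>) I1)"
      using k D_space by (auto simp: A_def space_pair_measure)
    then have "\<omega> \<in> E (k (D \<omega>))"
      using \<omega> k le by (auto simp: E_def B_def space_pair_measure space_PiM)
    then show ?thesis
      using k(1) by blast
  next
    case False
    \<comment> \<open>At level 0 the section has mass 1, which exceeds
      \<open>1 - \<alpha> - \<epsilon>\<close>, so this case contradicts \<open>le\<close>.\<close>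
    then have "Pair (D \<omega>) -` A = UNIV"
      using D_space by (auto simp: A_def space_pair_measure)
    then show ?thesis
      using le P.prob_space assms(2-4) by (simp add: P_def)
  qed
  have "measure M {\<omega> \<in> space M. p \<omega> \<le> 1 - \<alpha> - \<epsilon>} \<le> prob (\<Union>i\<in>{1..K}. E i)"
  proof (rule finite_measure_mono_AE)
    show "AE \<omega> in M. \<omega> \<in> {\<omega> \<in> space M. p \<omega> \<le> 1 - \<alpha> - \<epsilon>} \<longrightarrow> \<omega> \<in> (\<Union>i\<in>{1..K}. E i)"
      using p_eq by eventually_elim (use bad in auto)
    show "(\<Union>i\<in>{1..K}. E i) \<in> events"
      using E_sets by (intro sets.finite_UN) auto
  qed
  also have "\<dots> \<le> (\<Sum>i\<in>{1..K}. prob (E i))"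
    using E_sets by (intro finite_measure_subadditive_finite) auto
  also have "\<dots> \<le> (\<Sum>i\<in>{1..K}. exp (- 2 * \<epsilon>\<^sup>2 * real (card I2)))"
    by (intro sum_mono E_le)
  finally show ?thesis
    by simp
qed

end
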